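(* For integers $m>1$ let $$I_m=\int_{\mathcal S_m}|\det X|\,d\gamma_*(X),\qquad C(m)=\Big(\frac{4\pi}{m+4}\Big)^{\frac m2}\Gamma\Big(1+\frac m2\Big)I_m .$$ Then $$\log C(m)\sim\log I_m\sim\frac m2\log m\quad\text{as } m\to\infty,$$ where $a_m\sim b_m$ means $a_m/b_m\to1$.
   Context: $\mathcal S_m$ is the space of real symmetric $m\times m$ matrices $X=(x_{ij})$ and $\gamma_*$ is the centered Gaussian probability measure on $\mathcal S_m$ $$d\gamma_*(X)=\frac{1}{(2\pi)^{\frac{m(m+1)}4}\sqrt{\mu_m}}\,e^{-\frac14\left(\mathrm{tr}X^2-\frac1{m+2}(\mathrm{tr}X)^2\right)}\,2^{\frac12\binom m2}\prod_{i\le j}dx_{ij},\qquad \mu_m=2^{\binom m2+m-1}(m+2);$$ equivalently, its entries have covariances $E(x_{ii}^2)=3$, $E(x_{ii}x_{jj})=1$ for $i\ne j$, $E(x_{ij}^2)=1$ for $i<j$, and all other covariances of the entries $x_{ij}$, $i\le j$, vanish. $\Gamma$ is Euler's Gamma function. Motivation: $C(m)$ is introduced as the proportionality constant between the expected number of critical points of a Gaussian random function in the span of the Laplace eigenfunctions with eigenvalues $\le L$ on a compact connected $m$-dimensional Riemannian manifold and the dimension of that span, as $L\to\infty$. *)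

theory Defs
  imports
    "HOL-Analysis.Analysis"
    "HOL-Library.Landau_Symbols"
    "Jordan_Normal_Form.Determinant"
begin

text \<open>
  The order \<open>m\<close> varies inside the statement, so matrices are those of
  \<^typ>\<open>'a Matrix.mat\<close>, with indices running over \<open>0, \<dots>, m - 1\<close>.
\<close>

definition sym_mats :: "nat \<Rightarrow> real mat set" where
  "sym_mats m = {X \<in> carrier_mat m m. transpose_mat X = X}"

definition upper_idx :: "nat \<Rightarrow> (nat \<times> nat) set" where
  "upper_idx m = {(i, j). i \<le> j \<and> j < m}"

definition mat_of_upper :: "nat \<Rightarrow> (nat \<times> nat \<Rightarrow> real) \<Rightarrow> real mat" where
  "mat_of_upper m x = mat m m (\<lambda>(i, j). x (min i j, max i j))"

text \<open>The measure \<open>\<Prod>\<^bsub>i \<le> j\<^esub> dx\<^sub>i\<^sub>j\<close> on the symmetric matrices.\<close>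

definition sym_lebesgue :: "nat \<Rightarrow> real mat measure" where
  "sym_lebesgue m =
     embed_measure (PiM (upper_idx m) (\<lambda>_. lborel :: real measure)) (mat_of_upper m)"

lemma inj_on_mat_of_upper:
  "inj_on (mat_of_upper m) (space (PiM (upper_idx m) (\<lambda>_. lborel :: real measure)))"
proof (rule inj_onI)
  fix x y :: "nat \<times> nat \<Rightarrow> real"
  assume x: "x \<in> space (PiM (upper_idx m) (\<lambda>_. lborel))"
    and y: "y \<in> space (PiM (upper_idx m) (\<lambda>_. lborel))"
    and eq: "mat_of_upper m x = mat_of_upper m y"
  have "x (i, j) = y (i, j)" if "(i, j) \<in> upper_idx m" for i j
  proof -
    have ij: "i < m" "j < m" "i \<le> j" using that by (auto simp: upper_idx_def)
    have "mat_of_upper m x $$ (i, j) = mat_of_upper m y $$ (i, j)" using eq by simp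
    then show ?thesis using ij by (simp add: mat_of_upper_def min_absorb1 max_absorb2)
  qed
  then show "x = y"
    by (intro PiE_ext[OF x[unfolded space_PiM] y[unfolded space_PiM]]) (metis surj_pair)
qed

lemma space_sym_lebesgue: "space (sym_lebesgue m) = sym_mats m"
proof -
  have "mat_of_upper m ` (PiE (upper_idx m) (\<lambda>_. UNIV)) = sym_mats m"
  proof (intro equalityI subsetI)
    fix X assume "X \<in> mat_of_upper m ` (PiE (upper_idx m) (\<lambda>_. UNIV))"
    then obtain x where x: "X = mat_of_upper m x" by blast
    have "transpose_mat X = X"
      by (rule eq_matI) (simp_all add: x mat_of_upper_def min.commute max.commute)
    then show "X \<in> sym_mats m" by (simp add: x mat_of_upper_def sym_mats_def)
  next
    fix X assume X: "X \<in> sym_mats m"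
    define x where "x = restrict (\<lambda>p. X $$ p) (upper_idx m)"
    have sym: "X $$ (j, i) = X $$ (i, j)" if "i < m" "j < m" for i j
      using X that unfolding sym_mats_def
    proof -
      have "dim_row X = m" "dim_col X = m" "transpose_mat X = X"
        using X by (auto simp: sym_mats_def)
      then show ?thesis using that index_transpose_mat(1)[of i X j] by simp
    qed
    have "X = mat_of_upper m x"
    proof (rule eq_matI)
      fix i j assume "i < dim_row (mat_of_upper m x)" "j < dim_col (mat_of_upper m x)"
      then have ij: "i < m" "j < m" by (simp_all add: mat_of_upper_def)
      then show "X $$ (i, j) = mat_of_upper m x $$ (i, j)"
        using sym[OF ij]
        by (cases "i \<le> j") (simp_all add: mat_of_upper_def x_def upper_idx_def min_def max_def)
    qed (use X in \<open>auto simp: sym_mats_def mat_of_upper_def\<close>)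
    moreover have "x \<in> PiE (upper_idx m) (\<lambda>_. UNIV)" by (simp add: x_def)
    ultimately show "X \<in> mat_of_upper m ` (PiE (upper_idx m) (\<lambda>_. UNIV))" by blast
  qed
  then show ?thesis by (simp add: sym_lebesgue_def space_embed_measure space_PiM)
qed

definition mat_tr :: "real mat \<Rightarrow> real" where
  "mat_tr X = (\<Sum>i<dim_row X. X $$ (i, i))"

definition mu :: "nat \<Rightarrow> real" where
  "mu m = 2 ^ ((m choose 2) + m - 1) * real (m + 2)"

definition gamma_star_density :: "nat \<Rightarrow> real mat \<Rightarrow> real" where
  "gamma_star_density m X =
     1 / ((2 * pi) powr (real (m * (m + 1)) / 4) * sqrt (mu m))
       * exp (- (1 / 4) * (mat_tr (X * X) - 1 / real (m + 2) * (mat_tr X)\<^sup>2))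
       * 2 powr (1 / 2 * real (m choose 2))"

definition gamma_star :: "nat \<Rightarrow> real mat measure" where
  "gamma_star m = density (sym_lebesgue m) (\<lambda>X. ennreal (gamma_star_density m X))"

text \<open>\<^const>\<open>Determinant.det\<close> has to be qualified: \<open>HOL-Analysis\<close> has a \<open>det\<close> for matrices
  whose order is a type.\<close>

definition I_const :: "nat \<Rightarrow> real" where
  "I_const m = (\<integral>X. \<bar>Determinant.det X\<bar> \<partial>gamma_star m)"

definition C_const :: "nat \<Rightarrow> real" where
  "C_const m = (4 * pi / real (m + 4)) powr (real m / 2) * Gamma (1 + real m / 2) * I_const m"

end

theory Submission
  imports
    Defs
    "HOL-Probability.Probability"
    "HOL-Real_Asymp.Real_Asymp"
    "Jordan_Normal_Form.Char_Poly"
begin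

text \<open>
  Both \<open>ln (I_const m)\<close> and \<open>ln (C_const m)\<close> differ from \<open>m / 2 * ln m\<close> by at most a
  constant times \<open>m\<close>, which is negligible; so factors that are exponential in \<open>m\<close> may be
  lost freely.

  The density of \<^const>\<open>gamma_star\<close> contains the factor \<open>exp ((tr X)\<^sup>2 / (4 (m + 2)))\<close>, which
  couples the diagonal entries.  Writing it as a Gaussian integral of
  \<open>exp (g * tr X / 2)\<close> over \<open>g\<close> decouples them: under \<^const>\<open>gamma_star\<close> the matrix \<open>X\<close> has the
  law of \<open>Y + g * 1\<close>, where \<open>g\<close> is a standard normal variable and \<open>Y\<close> is independent of \<open>g\<close>
  with independent centred normal entries on and above the diagonal
  (lemma \<open>nn_integral_gamma_star\<close>).

  Upper bound.  By Hadamard's inequality and \<open>r \<le> L * exp (r / L)\<close>, the absolute determinant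
  is at most \<open>L powr (m / 2) * exp (\<Sum>\<^bsub>i,j\<^esub> x\<^sub>i\<^sub>j\<^sup>2 / (2 * L))\<close>.  For \<open>L = 8 * m\<close> there
  are about \<open>m\<^sup>2\<close> independent factors, each with mean \<open>1 + O(1 / m)\<close>, so the expectation
  of the exponential is only exponential in \<open>m\<close>, and the bound is \<open>m powr (m / 2)\<close> up to
  such a factor.

  Lower bound.  For fixed \<open>Y\<close> the function \<open>t \<mapsto> det (Y + t * 1)\<close> is a monic polynomial of
  degree \<open>m\<close>, whatever \<open>Y\<close> is.  Its \<open>m\<close>-th difference with step \<open>h\<close> is the constant
  \<open>m! * h ^ m\<close>, so a monic polynomial cannot be small at all of the points
  \<open>u, u + h, \<dots>, u + m * h\<close> (lemma \<open>det_shift_le_binomial_sum\<close>).  With \<open>h = 1 / sqrt m\<close> these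
  points stay in \<open>[0, 1 + sqrt m]\<close> for \<open>u \<in> [0, 1]\<close>, where the density of \<open>g\<close> is at least
  \<open>exp (- c * m)\<close> for a constant \<open>c\<close>; averaging over \<open>u\<close> and \<open>Y\<close> yields \<open>m! * m powr (- m / 2)\<close> up to
  an exponential factor, which again is \<open>m powr (m / 2)\<close>.

  For \<^const>\<open>C_const\<close>, the growth of \<open>\<Gamma>(1 + m / 2)\<close> cancels that of \<open>((m + 4) / (4 \<pi>)) powr (m / 2)\<close>
  up to an exponential factor (lemma \<open>Gamma_factor_bound\<close>).
\<close>

section \<open>Hadamard's inequality\<close>

text \<open>
  The matrix is the Householder reflection in the hyperplane orthogonal to \<open>v\<close>, an involution.
  For \<open>v = 0\<close> division by zero makes it the identity.
\<close>

lemma reflection_det_square: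
  fixes v :: "nat \<Rightarrow> real"
  assumes s_def: "s = (\<Sum>k<n. (v k)\<^sup>2)"
  shows "(Determinant.det (mat n n (\<lambda>(i,j). (if i = j then 1 else 0) - 2 / s * v i * v j)))\<^sup>2 = 1"
proof -
  define c where "c = 2 / s"
  define H where "H = mat n n (\<lambda>(i,j). (if i = j then 1 else 0) - c * v i * v j)"
  have cs: "c * c * s = 2 * c" by (cases "s = 0") (simp_all add: c_def)
  have "H * H = 1\<^sub>m n"
  proof (rule eq_matI)
    fix i j assume "i < dim_row (1\<^sub>m n :: real mat)" "j < dim_col (1\<^sub>m n :: real mat)"
    then have ij: "i < n" "j < n" by auto
    have "(H * H) $$ (i,j) = (\<Sum>k<n. ((if i = k then 1 else 0) - c * v i * v k) * ((if k = j then 1 else 0) - c * v k * v j))"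
      using ij by (simp add: H_def scalar_prod_def atLeast0LessThan)
    also have "\<dots> = (\<Sum>k<n. (if i = k then (if k = j then 1 else 0) - c * v k * v j else 0)
        - (if k = j then c * v i * v k else 0) + c * c * v i * v j * (v k)\<^sup>2)"
      by (intro sum.cong refl) (auto simp: algebra_simps power2_eq_square)
    also have "\<dots> = (if i = j then 1 else 0) - 2 * c * v i * v j + (c * c * s) * v i * v j"
      using ij by (simp add: sum.distrib sum_subtractf sum_distrib_left[symmetric] s_def)
    also have "\<dots> = (1\<^sub>m n :: real mat) $$ (i,j)" using ij by (simp add: cs)
    finally show "(H * H) $$ (i,j) = (1\<^sub>m n :: real mat) $$ (i,j)" .
  qed (simp_all add: H_def)
  then have "Determinant.det (H * H) = 1" by simp
  moreover have "Determinant.det (H * H) = (Determinant.det H)\<^sup>2"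
    by (subst det_mult[of _ n]) (simp_all add: H_def power2_eq_square)
  ultimately show ?thesis by (simp add: H_def c_def)
qed

text \<open>
  The reflection that exchanges the first row \<open>a 0\<close> and the vector \<open>(r, 0, \<dots>, 0)\<close> of the same
  length is applied to all rows; being orthogonal, it preserves their lengths.  This is the
  induction step for Hadamard's inequality.
\<close>

lemma rotate_first_row:
  fixes a :: "nat \<Rightarrow> nat \<Rightarrow> real"
  assumes n: "0 < n"
  obtains b where
    "(Determinant.det (mat n n (\<lambda>(i,j). b i j)))\<^sup>2 = (Determinant.det (mat n n (\<lambda>(i,j). a i j)))\<^sup>2"
    and "\<And>i. (\<Sum>j<n. (b i j)\<^sup>2) = (\<Sum>j<n. (a i j)\<^sup>2)"
    and "\<And>j. j < n \<Longrightarrow> j \<noteq> 0 \<Longrightarrow> b 0 j = 0"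
proof -
  define r where "r = sqrt (\<Sum>j<n. (a 0 j)\<^sup>2)"
  have r2: "(\<Sum>j<n. (a 0 j)\<^sup>2) = r\<^sup>2" by (simp add: r_def sum_nonneg)
  \<comment> \<open>\<open>v\<close> is normal to the perpendicular bisector of \<open>a 0\<close> and \<open>(r, 0, \<dots>, 0)\<close>.\<close>
  define v where "v = (\<lambda>j. a 0 j - (if j = 0 then r else 0))"
  define s where "s = (\<Sum>k<n. (v k)\<^sup>2)"
  define c where "c = 2 / s"
  define d where "d = (\<lambda>i. \<Sum>k<n. a i k * v k)"
  define b where "b = (\<lambda>i j. a i j - c * d i * v j)"
  define H where "H = mat n n (\<lambda>(i,j). (if i = j then 1 else 0) - 2 / s * v i * v j)"
  have zero: "v k = 0" if "s = 0" "k < n" for k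
    using that unfolding s_def by (subst (asm) sum_nonneg_eq_0_iff) auto
  \<comment> \<open>Equal lengths of the two vectors: this is what makes the reflection send \<open>a 0\<close> to
    \<open>(r, 0, \<dots>, 0)\<close>.\<close>
  have d0: "2 * d 0 = s"
  proof -
    have "d 0 = (\<Sum>k<n. (a 0 k)\<^sup>2 - (if k = 0 then r * a 0 k else 0))"
      unfolding d_def v_def by (intro sum.cong) (auto simp: power2_eq_square algebra_simps)
    also have "\<dots> = r\<^sup>2 - r * a 0 0" using n by (simp add: sum_subtractf r2)
    finally have 1: "d 0 = r\<^sup>2 - r * a 0 0" .
    have "s = (\<Sum>k<n. (a 0 k)\<^sup>2 - (if k = 0 then 2 * r * a 0 k - r\<^sup>2 else 0))"
      unfolding s_def v_def by (intro sum.cong) (auto simp: power2_eq_square algebra_simps)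
    also have "\<dots> = 2 * r\<^sup>2 - 2 * r * a 0 0" using n by (simp add: sum_subtractf r2)
    finally show ?thesis using 1 by simp
  qed
  have "mat n n (\<lambda>(i,j). b i j) = mat n n (\<lambda>(i,j). a i j) * H"
  proof (rule eq_matI)
    fix i j assume "i < dim_row (mat n n (\<lambda>(i,j). a i j) * H)" "j < dim_col (mat n n (\<lambda>(i,j). a i j) * H)"
    then have ij: "i < n" "j < n" by (auto simp: H_def)
    have "(mat n n (\<lambda>(i,j). a i j) * H) $$ (i,j) = (\<Sum>k<n. a i k * ((if k = j then 1 else 0) - c * v k * v j))"
      using ij by (simp add: H_def c_def scalar_prod_def atLeast0LessThan)
    also have "\<dots> = (\<Sum>k<n. (if k = j then a i k else 0) - c * v j * (a i k * v k))"
      by (intro sum.cong) (auto simp: algebra_simps)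
    also have "\<dots> = b i j" using ij by (simp add: sum_subtractf sum_distrib_left[symmetric] b_def d_def)
    finally show "mat n n (\<lambda>(i,j). b i j) $$ (i,j) = (mat n n (\<lambda>(i,j). a i j) * H) $$ (i,j)"
      using ij by simp
  qed (simp_all add: H_def)
  then have "Determinant.det (mat n n (\<lambda>(i,j). b i j)) = Determinant.det (mat n n (\<lambda>(i,j). a i j)) * Determinant.det H"
    by (simp add: det_mult[of _ n] H_def)
  moreover have "(Determinant.det H)\<^sup>2 = 1"
    unfolding H_def by (rule reflection_det_square[OF s_def])
  ultimately have "(Determinant.det (mat n n (\<lambda>(i,j). b i j)))\<^sup>2 = (Determinant.det (mat n n (\<lambda>(i,j). a i j)))\<^sup>2"
    by (simp add: power_mult_distrib)
  moreover have "(\<Sum>j<n. (b i j)\<^sup>2) = (\<Sum>j<n. (a i j)\<^sup>2)" for i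
  proof -
    have "(\<Sum>j<n. (b i j)\<^sup>2) = (\<Sum>j<n. (a i j)\<^sup>2 - 2 * c * d i * (a i j * v j) + c\<^sup>2 * (d i)\<^sup>2 * (v j)\<^sup>2)"
      by (intro sum.cong) (auto simp: b_def power2_eq_square algebra_simps)
    also have "\<dots> = (\<Sum>j<n. (a i j)\<^sup>2) - 2 * c * d i * d i + c\<^sup>2 * (d i)\<^sup>2 * s"
      by (simp add: sum.distrib sum_subtractf sum_distrib_left[symmetric] s_def d_def)
    also have "\<dots> = (\<Sum>j<n. (a i j)\<^sup>2)"
      by (cases "s = 0") (simp_all add: c_def field_simps power2_eq_square)
    finally show ?thesis .
  qed
  moreover have "b 0 j = 0" if "j < n" "j \<noteq> 0" for j
  proof (cases "s = 0")
    case True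
    then show ?thesis using that zero[OF True that(1)] by (simp add: b_def v_def)
  next
    case False
    then have "c * d 0 = 1" using d0 by (simp add: c_def field_simps)
    then show ?thesis using that by (simp add: b_def v_def)
  qed
  ultimately show ?thesis by (rule that)
qed

text \<open>
  Once the first row is a multiple of the first unit vector, Laplace expansion leaves one minor,
  and deleting a column only shortens the remaining rows.
\<close>

lemma hadamard_inequality:
  fixes a :: "nat \<Rightarrow> nat \<Rightarrow> real"
  shows "(Determinant.det (mat n n (\<lambda>(i,j). a i j)))\<^sup>2 \<le> (\<Prod>i<n. \<Sum>j<n. (a i j)\<^sup>2)"
proof (induction n arbitrary: a)
  case 0
  then show ?case by simp
next
  case (Suc n)
  obtain b where b: "(Determinant.det (mat (Suc n) (Suc n) (\<lambda>(i,j). b i j)))\<^sup>2 = (Determinant.det (mat (Suc n) (Suc n) (\<lambda>(i,j). a i j)))\<^sup>2"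
    and norm: "\<And>i. (\<Sum>j<Suc n. (b i j)\<^sup>2) = (\<Sum>j<Suc n. (a i j)\<^sup>2)"
    and b0: "\<And>j. j < Suc n \<Longrightarrow> j \<noteq> 0 \<Longrightarrow> b 0 j = 0"
    using rotate_first_row[of "Suc n" a] by auto
  define B where "B = mat (Suc n) (Suc n) (\<lambda>(i,j). b i j)"
  have del: "mat_delete B 0 0 = mat n n (\<lambda>(i,j). b (Suc i) (Suc j))"
    unfolding mat_delete_def B_def by (rule eq_matI) auto
  have "Determinant.det B = (\<Sum>j<Suc n. B $$ (0,j) * cofactor B 0 j)"
    by (rule laplace_expansion_row[of _ "Suc n"]) (simp_all add: B_def)
  also have "\<dots> = b 0 0 * cofactor B 0 0"
    by (subst sum.lessThan_Suc_shift) (simp add: B_def b0)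
  finally have "(Determinant.det B)\<^sup>2 = (b 0 0)\<^sup>2 * (Determinant.det (mat n n (\<lambda>(i,j). b (Suc i) (Suc j))))\<^sup>2"
    by (simp add: cofactor_def del power_mult_distrib)
  also have "\<dots> \<le> (b 0 0)\<^sup>2 * (\<Prod>i<n. \<Sum>j<n. (b (Suc i) (Suc j))\<^sup>2)"
    by (intro mult_left_mono Suc.IH) simp
  also have "\<dots> \<le> (\<Sum>j<Suc n. (b 0 j)\<^sup>2) * (\<Prod>i<n. \<Sum>j<Suc n. (b (Suc i) j)\<^sup>2)"
    by (intro mult_mono prod_mono conjI prod_nonneg sum_nonneg)
       (simp_all add: sum.lessThan_Suc_shift sum_nonneg del: sum.lessThan_Suc)
  also have "\<dots> = (\<Prod>i<Suc n. \<Sum>j<Suc n. (a i j)\<^sup>2)"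
    by (subst prod.lessThan_Suc_shift) (simp only: norm)
  finally show ?case using b by (simp add: B_def)
qed

text \<open>
  The exponential form replaces the product over rows, whose factors share entries when the
  matrix is symmetric, by a product over single entries, which are independent.
\<close>

lemma abs_det_le_exp_frobenius:
  fixes a :: "nat \<Rightarrow> nat \<Rightarrow> real"
  assumes L: "L > 0"
  shows "\<bar>Determinant.det (mat n n (\<lambda>(i,j). a i j))\<bar>
    \<le> L powr (real n / 2) * exp ((\<Sum>i<n. \<Sum>j<n. (a i j)\<^sup>2) / (2 * L))"
proof (rule power2_le_imp_le)
  have "\<bar>Determinant.det (mat n n (\<lambda>(i,j). a i j))\<bar>\<^sup>2 \<le> (\<Prod>i<n. \<Sum>j<n. (a i j)\<^sup>2)"
    using hadamard_inequality[of n a] by simp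
  also have "\<dots> \<le> (\<Prod>i<n. L * exp ((\<Sum>j<n. (a i j)\<^sup>2) / L))"
  proof (intro prod_mono conjI sum_nonneg)
    fix i
    define y where "y = (\<Sum>j<n. (a i j)\<^sup>2) / L"
    have "y \<le> exp y" using exp_ge_add_one_self[of y] by linarith
    then have "L * y \<le> L * exp y" using L by simp
    then show "(\<Sum>j<n. (a i j)\<^sup>2) \<le> L * exp ((\<Sum>j<n. (a i j)\<^sup>2) / L)"
      using L by (simp add: y_def)
  qed simp
  also have "\<dots> = L ^ n * exp ((\<Sum>i<n. \<Sum>j<n. (a i j)\<^sup>2) / L)"
    by (simp add: prod.distrib exp_sum[symmetric] sum_divide_distrib)
  also have "\<dots> = (L powr (real n / 2) * exp ((\<Sum>i<n. \<Sum>j<n. (a i j)\<^sup>2) / (2 * L)))\<^sup>2"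
    using L by (simp add: power_mult_distrib powr_realpow[symmetric] powr_powr powr_power exp_double[symmetric])
  finally show "\<bar>Determinant.det (mat n n (\<lambda>(i,j). a i j))\<bar>\<^sup>2
    \<le> (L powr (real n / 2) * exp ((\<Sum>i<n. \<Sum>j<n. (a i j)\<^sup>2) / (2 * L)))\<^sup>2" .
qed simp

section \<open>Finite differences of the characteristic polynomial\<close>

text \<open>
  The operator \<open>p(x) \<mapsto> p(x + h) - p(x)\<close> acts on leading terms like \<open>h\<close> times the derivative.
\<close>

lemma degree_shift_difference:
  fixes p :: "real poly"
  assumes "degree p \<le> Suc n"
  shows "degree (pcompose p [:h, 1:] - p) \<le> n
    \<and> coeff (pcompose p [:h, 1:] - p) n = real (Suc n) * h * coeff p (Suc n)"
  using assms
proof (induction n arbitrary: p)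
  case 0
  obtain a q where p: "p = pCons a q" by (cases p) 
  have "degree q \<le> 0" using 0 p by (cases "q = 0") auto
  then obtain b where "q = [:b:]" using degree_eq_zeroE by blast
  then show ?case by (simp add: p pcompose_pCons algebra_simps)
next
  case (Suc n)
  obtain a q where p: "p = pCons a q" by (cases p) 
  have q: "degree q \<le> Suc n" using Suc.prems p by (cases "q = 0") auto
  define D where "D = pcompose q [:h, 1:] - q"
  have D: "degree D \<le> n" "coeff D n = real (Suc n) * h * coeff q (Suc n)"
    using Suc.IH[OF q] by (auto simp: D_def)
  have eq: "pcompose p [:h, 1:] - p = pCons 0 D + Polynomial.smult h (q + D)"
    by (simp add: p pcompose_pCons D_def algebra_simps)
  have "degree (pCons 0 D) \<le> Suc n" using D(1) by (cases "D = 0") auto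
  moreover have "degree (Polynomial.smult h (q + D)) \<le> Suc n"
    using q D(1) by (intro degree_smult_le[THEN order_trans] degree_add_le) auto
  moreover have "coeff D (Suc n) = 0" using D(1) by (simp add: coeff_eq_0)
  ultimately show ?case unfolding eq using D(2)
    by (auto intro!: degree_add_le simp: p algebra_simps)
qed

text \<open>
  The triangle inequality for the \<open>n\<close>-th difference of \<open>p\<close> with step \<open>h\<close>, which is the constant
  \<open>n! * h ^ n * coeff p n\<close>.  The induction applies one difference and merges the two
  resulting binomial sums by Pascal's rule.
\<close>

lemma leading_coeff_le_binomial_sum:
  fixes p :: "real poly"
  assumes "degree p \<le> n" and h: "h \<ge> 0"
  shows "fact n * h ^ n * \<bar>coeff p n\<bar> \<le> (\<Sum>k\<le>n. real (n choose k) * \<bar>poly p (x + real k * h)\<bar>)"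
  using assms(1)
proof (induction n arbitrary: p)
  case 0
  then obtain b where "p = [:b:]" using degree_eq_zeroE by blast
  then show ?case by simp
next
  case (Suc n)
  define D where "D = pcompose p [:h, 1:] - p"
  have D: "degree D \<le> n" "coeff D n = real (Suc n) * h * coeff p (Suc n)"
    using degree_shift_difference[OF Suc.prems] by (auto simp: D_def)
  define f where "f = (\<lambda>k. \<bar>poly p (x + real k * h)\<bar>)"
  have "fact (Suc n) * h ^ Suc n * \<bar>coeff p (Suc n)\<bar> = fact n * h ^ n * \<bar>coeff D n\<bar>"
    using h by (simp add: D(2) abs_mult del: of_nat_Suc)
  also have "\<dots> \<le> (\<Sum>k\<le>n. real (n choose k) * \<bar>poly D (x + real k * h)\<bar>)"
    by (rule Suc.IH[OF D(1)])
  also have "\<dots> \<le> (\<Sum>k\<le>n. real (n choose k) * (f (Suc k) + f k))"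
  proof (intro sum_mono mult_left_mono)
    fix k
    have "poly D (x + real k * h) = poly p (x + real (Suc k) * h) - poly p (x + real k * h)"
      by (simp add: D_def poly_pcompose algebra_simps)
    then show "\<bar>poly D (x + real k * h)\<bar> \<le> f (Suc k) + f k" by (simp add: f_def)
  qed simp
  also have "\<dots> = (\<Sum>k\<le>n. real (n choose k) * f (Suc k)) + (f 0 + (\<Sum>k\<le>n. real (n choose Suc k) * f (Suc k)))"
  proof -
    have "(\<Sum>k\<le>n. real (n choose k) * f k) = (\<Sum>k\<le>Suc n. real (n choose k) * f k)"
      by simp
    also have "\<dots> = f 0 + (\<Sum>k\<le>n. real (n choose Suc k) * f (Suc k))"
      by (subst sum.atMost_Suc_shift) simp
    finally show ?thesis by (simp add: distrib_left sum.distrib)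
  qed
  also have "\<dots> = (\<Sum>k\<le>Suc n. real (Suc n choose k) * f k)"
    unfolding sum.atMost_Suc_shift by (simp add: sum.distrib distrib_right)
  finally show ?case by (simp add: f_def)
qed

text \<open>
  The left-hand side does not depend on \<open>a\<close>, because the characteristic polynomial is monic.
  This uniformity is what gives the lower bound for the mean.
\<close>

lemma det_shift_le_binomial_sum:
  fixes a :: "nat \<Rightarrow> nat \<Rightarrow> real"
  assumes h: "h \<ge> 0"
  shows "fact n * h ^ n \<le> (\<Sum>k\<le>n. real (n choose k) *
    \<bar>Determinant.det (mat n n (\<lambda>(i,j). a i j + (if i = j then u + real k * h else 0)))\<bar>)"
proof -
  \<comment> \<open>The sign turns the roots of the characteristic polynomial into shifts by \<open>+ t\<close>.\<close>
  define A where "A = mat n n (\<lambda>(i,j). - a i j)"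
  have A: "A \<in> carrier_mat n n" by (simp add: A_def)
  have ev: "poly (char_poly A) t = Determinant.det (mat n n (\<lambda>(i,j). a i j + (if i = j then t else 0)))" for t
  proof -
    have "- char_matrix A t = mat n n (\<lambda>(i,j). a i j + (if i = j then t else 0))"
      by (rule eq_matI) (auto simp: char_matrix_def A_def)
    then show ?thesis using char_poly_matrix[OF A, of t] by simp
  qed
  show ?thesis
    using leading_coeff_le_binomial_sum[of "char_poly A" n h u] degree_monic_char_poly[OF A] h
    by (simp add: ev)
qed

section \<open>Sums over the entries of a symmetric matrix\<close>

definition strict_upper_idx :: "nat \<Rightarrow> (nat \<times> nat) set" where
  "strict_upper_idx m = {(i, j). i < j \<and> j < m}"

lemma mem_strict_upper_idx [simp]: "(i, j) \<in> strict_upper_idx m \<longleftrightarrow> i < j \<and> j < m"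
  by (simp add: strict_upper_idx_def)

lemma strict_upper_idx_Suc:
  "strict_upper_idx (Suc m) = strict_upper_idx m \<union> (\<lambda>i. (i, m)) ` {..<m}"
  by (auto simp: strict_upper_idx_def less_Suc_eq)

lemma finite_strict_upper_idx [simp]: "finite (strict_upper_idx m)"
  by (rule finite_subset[of _ "{..<m} \<times> {..<m}"]) (auto simp: strict_upper_idx_def)

lemma sum_strict_upper_idx_Suc:
  "sum f (strict_upper_idx (Suc m)) = sum f (strict_upper_idx m) + (\<Sum>i<m. f (i, m))"
  unfolding strict_upper_idx_Suc
  by (subst sum.union_disjoint) (auto simp: sum.reindex inj_on_def)

lemma card_strict_upper_idx: "card (strict_upper_idx m) = m choose 2"
proof (induction m)
  case 0
  then show ?case by (simp add: strict_upper_idx_def)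
next
  case (Suc m)
  then show ?case using sum_strict_upper_idx_Suc[of "\<lambda>_. 1::nat" m]
    by (simp add: numeral_2_eq_2)
qed

lemma upper_idx_eq: "upper_idx m = (\<lambda>i. (i, i)) ` {..<m} \<union> strict_upper_idx m"
  by (auto simp: upper_idx_def strict_upper_idx_def)

lemma finite_upper_idx [simp]: "finite (upper_idx m)"
  by (simp add: upper_idx_eq)

lemma sum_upper_idx: "sum f (upper_idx m) = (\<Sum>i<m. f (i, i)) + sum f (strict_upper_idx m)"
  unfolding upper_idx_eq
  by (subst sum.union_disjoint) (auto simp: sum.reindex inj_on_def)

lemma prod_upper_idx: "prod f (upper_idx m) = (\<Prod>i<m. f (i, i)) * prod f (strict_upper_idx m)"
  unfolding upper_idx_eq
  by (subst prod.union_disjoint) (auto simp: prod.reindex inj_on_def)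

lemma sum_symmetric_entries:
  fixes x :: "nat \<times> nat \<Rightarrow> real"
  shows "(\<Sum>i<m. \<Sum>j<m. (x (min i j, max i j))\<^sup>2)
    = (\<Sum>i<m. (x (i, i))\<^sup>2) + 2 * (\<Sum>p\<in>strict_upper_idx m. (x p)\<^sup>2)"
proof (induction m)
  case 0
  then show ?case by (simp add: strict_upper_idx_def)
next
  case (Suc m)
  have "(\<Sum>i<Suc m. \<Sum>j<Suc m. (x (min i j, max i j))\<^sup>2)
    = (\<Sum>i<m. \<Sum>j<m. (x (min i j, max i j))\<^sup>2) + (\<Sum>i<m. (x (min i m, max i m))\<^sup>2)
      + (\<Sum>j<m. (x (min m j, max m j))\<^sup>2) + (x (m, m))\<^sup>2"
    by (simp add: sum.distrib)
  also have "(\<Sum>i<m. (x (min i m, max i m))\<^sup>2) = (\<Sum>i<m. (x (i, m))\<^sup>2)"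
    by (intro sum.cong) (auto simp: min_def max_def)
  also have "(\<Sum>j<m. (x (min m j, max m j))\<^sup>2) = (\<Sum>i<m. (x (i, m))\<^sup>2)"
    by (intro sum.cong) (auto simp: min_def max_def)
  finally show ?case by (simp add: Suc sum_strict_upper_idx_Suc)
qed

section \<open>Products of Gaussian measures on the line\<close>

lemma density_PiM_lborel:
  fixes f :: "'i \<Rightarrow> real \<Rightarrow> ennreal"
  assumes I: "finite I" and f [measurable]: "\<And>i. f i \<in> borel_measurable borel"
    and prob: "\<And>i. prob_space (density lborel (f i))"
  shows "density (PiM I (\<lambda>_. lborel)) (\<lambda>x. \<Prod>i\<in>I. f i (x i)) = PiM I (\<lambda>i. density lborel (f i))"
proof -
  interpret P: product_prob_space "\<lambda>i. density lborel (f i)"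
    by (rule product_prob_spaceI) (rule prob)
  interpret L: product_sigma_finite "\<lambda>_::'i. lborel :: real measure"
    by standard
  show ?thesis
  proof (rule P.PiM_eqI[OF I])
    show "sets (density (PiM I (\<lambda>_. lborel)) (\<lambda>x. \<Prod>i\<in>I. f i (x i))) = sets (PiM I (\<lambda>i. density lborel (f i)))"
      by (simp, intro sets_PiM_cong) simp_all
    fix A assume A: "\<And>i. i \<in> I \<Longrightarrow> A i \<in> sets (density lborel (f i))"
    have A' [measurable]: "A i \<in> sets borel" if "i \<in> I" for i using A[OF that] by simp
    have *: "indicator (PiE I A) x = (\<Prod>i\<in>I. indicator (A i) (x i) :: ennreal)"
      if x: "x \<in> space (PiM I (\<lambda>_. lborel :: real measure))" for x
    proof (cases "x \<in> PiE I A")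
      case True
      then have "(\<Prod>i\<in>I. indicator (A i) (x i) :: ennreal) = (\<Prod>i\<in>I. 1)"
        by (intro prod.cong) (auto simp: PiE_iff)
      then show ?thesis using True by simp
    next
      case False
      then obtain i where "i \<in> I" "x i \<notin> A i" using x by (auto simp: space_PiM PiE_iff)
      then have "(\<Prod>i\<in>I. indicator (A i) (x i) :: ennreal) = 0"
        using I by (auto simp: indicator_def)
      then show ?thesis using False by simp
    qed
    have "emeasure (density (PiM I (\<lambda>_. lborel)) (\<lambda>x. \<Prod>i\<in>I. f i (x i))) (PiE I A)
        = (\<integral>\<^sup>+x. (\<Prod>i\<in>I. f i (x i)) * indicator (PiE I A) x \<partial>PiM I (\<lambda>_. lborel))"
      using I by (intro emeasure_density sets_PiM_I_finite) (auto intro!: A')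
    also have "\<dots> = (\<integral>\<^sup>+x. (\<Prod>i\<in>I. f i (x i) * indicator (A i) (x i)) \<partial>PiM I (\<lambda>_. lborel))"
      by (intro nn_integral_cong) (simp add: * prod.distrib)
    also have "\<dots> = (\<Prod>i\<in>I. \<integral>\<^sup>+y. f i y * indicator (A i) y \<partial>lborel)"
      by (rule L.product_nn_integral_prod[OF I, where f="\<lambda>i y. f i y * indicator (A i) y"]) simp
    also have "\<dots> = (\<Prod>i\<in>I. emeasure (density lborel (f i)) (A i))"
      by (intro prod.cong refl emeasure_density[symmetric]) (auto intro!: A')
    finally show "emeasure (density (PiM I (\<lambda>_. lborel)) (\<lambda>x. \<Prod>i\<in>I. f i (x i))) (PiE I A)
        = (\<Prod>i\<in>I. emeasure (density lborel (f i)) (A i))" .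
  qed
qed

lemma distr_PiM_componentwise:
  assumes I: "finite I" and M: "\<And>i. prob_space (M i)"
    and T [measurable]: "\<And>i. T i \<in> measurable (M i) (N i)"
  shows "distr (PiM I M) (PiM I N) (\<lambda>x. \<lambda>i\<in>I. T i (x i)) = PiM I (\<lambda>i. distr (M i) (N i) (T i))"
proof -
  interpret M: product_prob_space M by (rule product_prob_spaceI) (rule M)
  interpret D: product_prob_space "\<lambda>i. distr (M i) (N i) (T i)"
    by (rule product_prob_spaceI) (rule prob_space.prob_space_distr[OF M T])
  show ?thesis
  proof (rule D.PiM_eqI[OF I])
    show "sets (distr (PiM I M) (PiM I N) (\<lambda>x. \<lambda>i\<in>I. T i (x i))) = sets (PiM I (\<lambda>i. distr (M i) (N i) (T i)))"
      by (simp, intro sets_PiM_cong) simp_all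
    fix A assume A: "\<And>i. i \<in> I \<Longrightarrow> A i \<in> sets (distr (M i) (N i) (T i))"
    have meas: "(\<lambda>x. \<lambda>i\<in>I. T i (x i)) \<in> measurable (PiM I M) (PiM I N)"
      by measurable
    have "emeasure (distr (PiM I M) (PiM I N) (\<lambda>x. \<lambda>i\<in>I. T i (x i))) (PiE I A)
        = emeasure (PiM I M) ((\<lambda>x. \<lambda>i\<in>I. T i (x i)) -` PiE I A \<inter> space (PiM I M))"
      using A I by (intro emeasure_distr meas sets_PiM_I_finite) auto
    also have "(\<lambda>x. \<lambda>i\<in>I. T i (x i)) -` PiE I A \<inter> space (PiM I M)
        = PiE I (\<lambda>i. T i -` A i \<inter> space (M i))"
      by (auto simp: space_PiM PiE_iff)
    also have "emeasure (PiM I M) \<dots> = (\<Prod>i\<in>I. emeasure (M i) (T i -` A i \<inter> space (M i)))"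
      using A by (intro M.emeasure_PiM I measurable_sets[OF T]) auto
    also have "\<dots> = (\<Prod>i\<in>I. emeasure (distr (M i) (N i) (T i)) (A i))"
      using A by (intro prod.cong refl emeasure_distr[symmetric] T) auto
    finally show "emeasure (distr (PiM I M) (PiM I N) (\<lambda>x. \<lambda>i\<in>I. T i (x i))) (PiE I A)
        = (\<Prod>i\<in>I. emeasure (distr (M i) (N i) (T i)) (A i))" .
  qed
qed

lemma distr_normal_add:
  assumes "\<sigma> > 0"
  shows "distr (density lborel (normal_density 0 \<sigma>)) lborel (\<lambda>x. x + c) = density lborel (normal_density c \<sigma>)"
proof -
  interpret prob_space "density lborel (normal_density 0 \<sigma>)"
    by (rule prob_space_normal_density) fact
  have "distributed (density lborel (normal_density 0 \<sigma>)) lborel (\<lambda>x. x) (normal_density 0 \<sigma>)"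
    unfolding distributed_def by (auto intro!: distr_id2)
  from normal_density_affine[OF this assms, of 1 c] show ?thesis
    by (auto simp: distributed_def add.commute)
qed

text \<open>
  The integral equals \<open>(1 - y) powr (- 1 / 2)\<close> with \<open>y = 2 * a * \<sigma>\<^sup>2\<close>, since the integrand
  is a multiple of the normal density with variance \<open>\<sigma>\<^sup>2 / (1 - y)\<close>; for \<open>y \<le> 1 / 2\<close> this
  is at most \<open>exp (2 * y)\<close>.
\<close>

lemma nn_integral_normal_exp_square_le:
  assumes "\<sigma> > 0" "a \<ge> 0" "4 * a * \<sigma>\<^sup>2 \<le> 1"
  shows "(\<integral>\<^sup>+x. ennreal (normal_density 0 \<sigma> x * exp (a * x\<^sup>2)) \<partial>lborel) \<le> ennreal (exp (4 * a * \<sigma>\<^sup>2))"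
proof -
  define y where "y = 2 * a * \<sigma>\<^sup>2"
  have y: "0 \<le> y" "y \<le> 1/2" using assms by (auto simp: y_def)
  define \<tau> where "\<tau> = \<sigma> / sqrt (1 - y)"
  have \<tau>: "\<tau> > 0" using assms y by (simp add: \<tau>_def)
  have t2: "\<tau>\<^sup>2 = \<sigma>\<^sup>2 / (1 - y)" using y by (simp add: \<tau>_def power_divide)
  have eq: "normal_density 0 \<sigma> x * exp (a * x\<^sup>2) = 1 / sqrt (1 - y) * normal_density 0 \<tau> x" for x
  proof -
    have "- x\<^sup>2 / (2 * \<sigma>\<^sup>2) + a * x\<^sup>2 = - x\<^sup>2 / (2 * \<tau>\<^sup>2)"
      using assms(1) by (simp add: t2 y_def field_simps)
    moreover have "1 / sqrt (2 * pi * \<sigma>\<^sup>2) = 1 / sqrt (1 - y) * (1 / sqrt (2 * pi * \<tau>\<^sup>2))"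
      using assms(1) y by (simp add: t2 real_sqrt_divide real_sqrt_mult field_simps)
    ultimately show ?thesis unfolding normal_density_def
      by (simp add: exp_add[symmetric] mult.assoc)
  qed
  have "(\<integral>\<^sup>+x. ennreal (normal_density 0 \<sigma> x * exp (a * x\<^sup>2)) \<partial>lborel)
      = (\<integral>\<^sup>+x. ennreal (1 / sqrt (1 - y)) * ennreal (normal_density 0 \<tau> x) \<partial>lborel)"
    using y by (intro nn_integral_cong) (simp add: eq ennreal_mult'[symmetric])
  also have "\<dots> = ennreal (1 / sqrt (1 - y)) * (\<integral>\<^sup>+x. ennreal (normal_density 0 \<tau> x) \<partial>lborel)"
    by (rule nn_integral_cmult) simp
  also have "(\<integral>\<^sup>+x. ennreal (normal_density 0 \<tau> x) \<partial>lborel) = 1"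
    using \<tau> by (simp add: nn_integral_eq_integral)
  also have "ennreal (1 / sqrt (1 - y)) * 1 \<le> ennreal (exp (4 * a * \<sigma>\<^sup>2))"
  proof -
    have "1 - y \<le> sqrt (1 - y)" using y
      by (intro real_le_rsqrt) (simp add: power2_eq_square mult_left_le)
    then have "1 / sqrt (1 - y) \<le> 1 / (1 - y)" using y by (intro divide_left_mono) auto
    also have "\<dots> \<le> 1 + 2 * y"
    proof -
      have "0 \<le> y * (1 - 2 * y)" using y by (intro mult_nonneg_nonneg) auto
      then show ?thesis using y by (simp add: field_simps)
    qed
    also have "\<dots> \<le> exp (2 * y)" by (rule exp_ge_add_one_self)
    finally show ?thesis by (simp add: y_def ennreal_leI mult.assoc)
  qed
  finally show ?thesis .
qed

section \<open>The Gaussian measure as a randomly shifted orthogonal ensemble\<close>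

definition entry_sd :: "nat \<times> nat \<Rightarrow> real" where
  "entry_sd p = (if fst p = snd p then sqrt 2 else 1)"

lemma entry_sd_pos [simp]: "entry_sd p > 0"
  by (simp add: entry_sd_def)

definition on_diag :: "real \<Rightarrow> nat \<times> nat \<Rightarrow> real" where
  "on_diag t p = (if fst p = snd p then t else 0)"

text \<open>
  Addition of \<open>t\<close> times the identity matrix, in the coordinates of \<^const>\<open>mat_of_upper\<close>.  The
  restriction keeps the result in the space of the product measure.
\<close>

definition shift_diag :: "nat \<Rightarrow> real \<Rightarrow> (nat \<times> nat \<Rightarrow> real) \<Rightarrow> nat \<times> nat \<Rightarrow> real" where
  "shift_diag m t x = (\<lambda>p\<in>upper_idx m. x p + on_diag t p)"

text \<open>
  The Gaussian orthogonal ensemble in the coordinates of \<^const>\<open>mat_of_upper\<close>.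
\<close>

definition goe :: "nat \<Rightarrow> (nat \<times> nat \<Rightarrow> real) measure" where
  "goe m = PiM (upper_idx m) (\<lambda>p. density lborel (normal_density 0 (entry_sd p)))"

abbreviation upper_lborel :: "nat \<Rightarrow> (nat \<times> nat \<Rightarrow> real) measure" where
  "upper_lborel m \<equiv> PiM (upper_idx m) (\<lambda>_. lborel)"

lemma sets_goe [measurable_cong]: "sets (goe m) = sets (upper_lborel m)"
  unfolding goe_def by (intro sets_PiM_cong) simp_all

lemma prob_space_goe: "prob_space (goe m)"
  unfolding goe_def by (intro prob_space_PiM prob_space_normal_density) simp

lemma sigma_finite_upper_lborel: "sigma_finite_measure (upper_lborel m)"
proof -
  interpret product_sigma_finite "\<lambda>_::nat\<times>nat. lborel :: real measure" by standard
  show ?thesis by (rule sigma_finite) simp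
qed

lemma measurable_shift_diag:
  "(\<lambda>(t, x). shift_diag m t x) \<in> measurable (borel \<Otimes>\<^sub>M upper_lborel m) (upper_lborel m)"
proof -
  have "(\<lambda>z. \<lambda>p\<in>upper_idx m. snd z p + on_diag (fst z) p) \<in> measurable (borel \<Otimes>\<^sub>M upper_lborel m) (upper_lborel m)"
    unfolding on_diag_def by measurable
  then show ?thesis by (simp add: shift_diag_def case_prod_beta')
qed

lemma measurable_upper_entry [measurable]:
  assumes "i < m" "j < m"
  shows "(\<lambda>x. mat_of_upper m x $$ (i, j)) \<in> borel_measurable (upper_lborel m)"
proof -
  have "(min i j, max i j) \<in> upper_idx m" using assms by (auto simp: upper_idx_def)
  then have "(\<lambda>x. x (min i j, max i j)) \<in> measurable (upper_lborel m) lborel"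
    by (rule measurable_component_singleton)
  then show ?thesis using assms by (simp add: mat_of_upper_def)
qed

lemma measurable_det_upper [measurable]:
  "(\<lambda>x. Determinant.det (mat_of_upper m x)) \<in> borel_measurable (upper_lborel m)"
proof -
  have eq: "Determinant.det (mat_of_upper m x) = (\<Sum>p | p permutes {0..<m}. signof p * (\<Prod>i = 0..<m. mat_of_upper m x $$ (i, p i)))" for x
    by (rule det_def') (simp add: mat_of_upper_def)
  show ?thesis unfolding eq
    by (intro borel_measurable_sum borel_measurable_times borel_measurable_const borel_measurable_prod measurable_upper_entry)
       (auto dest: permutes_in_image)
qed

lemma nn_integral_goe_shift:
  assumes f: "f \<in> borel_measurable (upper_lborel m)"
  shows "(\<integral>\<^sup>+x. f (shift_diag m t x) \<partial>goe m)
    = (\<integral>\<^sup>+x. ennreal (\<Prod>p\<in>upper_idx m. normal_density (on_diag t p) (entry_sd p) (x p)) * f x \<partial>upper_lborel m)"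
proof -
  let ?N = "\<lambda>c p. density lborel (normal_density c (entry_sd p))"
  have [measurable]: "shift_diag m t \<in> measurable (goe m) (upper_lborel m)"
    using measurable_compose[OF _ measurable_shift_diag, of "Pair t" "goe m" m] by simp
  have "distr (goe m) (upper_lborel m) (shift_diag m t)
      = PiM (upper_idx m) (\<lambda>p. distr (?N 0 p) lborel (\<lambda>y. y + on_diag t p))"
    unfolding goe_def shift_diag_def
    by (rule distr_PiM_componentwise) (simp_all add: prob_space_normal_density)
  also have "\<dots> = PiM (upper_idx m) (\<lambda>p. ?N (on_diag t p) p)"
    by (simp add: distr_normal_add)
  also have "\<dots> = density (upper_lborel m) (\<lambda>x. \<Prod>p\<in>upper_idx m. ennreal (normal_density (on_diag t p) (entry_sd p) (x p)))"
    by (rule density_PiM_lborel[symmetric]) (simp_all add: prob_space_normal_density)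
  finally have eq: "distr (goe m) (upper_lborel m) (shift_diag m t) = \<dots>" .
  have "(\<integral>\<^sup>+x. f (shift_diag m t x) \<partial>goe m) = (\<integral>\<^sup>+x. f x \<partial>distr (goe m) (upper_lborel m) (shift_diag m t))"
    using f by (subst nn_integral_distr) simp_all
  also have "\<dots> = (\<integral>\<^sup>+x. (\<Prod>p\<in>upper_idx m. ennreal (normal_density (on_diag t p) (entry_sd p) (x p))) * f x \<partial>upper_lborel m)"
    unfolding eq using f by (subst nn_integral_density) auto
  finally show ?thesis by (simp add: prod_ennreal)
qed

lemma mat_tr_mat_of_upper: "mat_tr (mat_of_upper m x) = (\<Sum>i<m. x (i, i))"
  by (simp add: mat_tr_def mat_of_upper_def)

lemma mat_tr_square_mat_of_upper:
  "mat_tr (mat_of_upper m x * mat_of_upper m x)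
    = (\<Sum>i<m. (x (i, i))\<^sup>2) + 2 * (\<Sum>p\<in>strict_upper_idx m. (x p)\<^sup>2)"
proof -
  have "mat_tr (mat_of_upper m x * mat_of_upper m x) = (\<Sum>i<m. \<Sum>j<m. (x (min i j, max i j))\<^sup>2)"
    unfolding mat_tr_def mat_of_upper_def
    by (auto simp: scalar_prod_def atLeast0LessThan power2_eq_square min.commute max.commute intro!: sum.cong)
  then show ?thesis by (simp add: sum_symmetric_entries)
qed

lemma gamma_star_density_nonneg: "0 \<le> gamma_star_density m X"
  by (simp add: gamma_star_density_def mu_def)

text \<open>
  Completing the square in \<open>g\<close>.  The first factor on the right is free of \<open>g\<close> and the second is
  a probability density in \<open>g\<close>, so integrating over \<open>g\<close> recovers the density of
  \<^const>\<open>gamma_star\<close>; in particular the normalising constants match.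
\<close>

lemma gaussian_factorisation:
  assumes m: "m > 0"
  shows "std_normal_density g * (\<Prod>p\<in>upper_idx m. normal_density (on_diag g p) (entry_sd p) (x p))
    = gamma_star_density m (mat_of_upper m x)
      * normal_density ((\<Sum>i<m. x (i, i)) / real (m + 2)) (sqrt (2 / real (m + 2))) g"
proof -
  define S where "S = (\<Sum>i<m. x (i, i))"
  define D where "D = (\<Sum>i<m. (x (i, i))\<^sup>2)"
  define R where "R = (\<Sum>p\<in>strict_upper_idx m. (x p)\<^sup>2)"
  define M where "M = real (m + 2)"
  have M: "M > 0" and M2: "real m + 2 = M" "2 + real m = M" by (simp_all add: M_def)
  define b where "b = (m choose 2)"
  have diag: "(\<Prod>i<m. normal_density (on_diag g (i,i)) (entry_sd (i,i)) (x (i,i)))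
     = (1 / sqrt (4 * pi)) ^ m * exp (- (D - 2 * g * S + real m * g\<^sup>2) / 4)"
  proof -
    have "(\<Sum>i<m. - (x (i,i) - g)\<^sup>2 / 4) = - (D - 2 * g * S + real m * g\<^sup>2) / 4"
      by (simp add: D_def S_def power2_diff sum.distrib sum_subtractf sum_negf sum_divide_distrib[symmetric] sum_distrib_left sum_distrib_right algebra_simps)
    then show ?thesis
      by (simp add: normal_density_def on_diag_def entry_sd_def prod.distrib exp_sum[symmetric] power_divide prod_dividef)
  qed
  have off: "(\<Prod>p\<in>strict_upper_idx m. normal_density (on_diag g p) (entry_sd p) (x p))
     = (1 / sqrt (2 * pi)) ^ b * exp (- R / 2)"
  proof -
    have "(\<Prod>p\<in>strict_upper_idx m. normal_density (on_diag g p) (entry_sd p) (x p))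
      = (\<Prod>p\<in>strict_upper_idx m. 1 / sqrt (2 * pi) * exp (- (x p)\<^sup>2 / 2))"
      by (intro prod.cong) (auto simp: normal_density_def on_diag_def entry_sd_def strict_upper_idx_def)
    also have "\<dots> = (1 / sqrt (2 * pi)) ^ b * exp (\<Sum>p\<in>strict_upper_idx m. - (x p)\<^sup>2 / 2)"
      by (simp add: prod.distrib exp_sum card_strict_upper_idx b_def prod_dividef power_divide)
    also have "(\<Sum>p\<in>strict_upper_idx m. - (x p)\<^sup>2 / 2) = - R / 2"
      by (simp add: R_def sum_negf sum_divide_distrib[symmetric])
    finally show ?thesis .
  qed
  have const: "1 / sqrt (2 * pi) * ((1 / sqrt (4 * pi)) ^ m * (1 / sqrt (2 * pi)) ^ b)
    = 1 / ((2 * pi) powr (real (m * (m + 1)) / 4) * sqrt (mu m)) * 2 powr (1 / 2 * real b) * (1 / sqrt (2 * pi * (2 / M)))"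
  proof -
    have bm: "real (m * (m + 1)) / 4 = real b / 2 + real m / 2"
    proof -
      have "2 * b + 2 * m = m * (m + 1)"
        unfolding b_def by (induction m) (simp_all add: numeral_2_eq_2)
      then have "real (m * (m + 1)) = 2 * real b + 2 * real m" by (metis of_nat_add of_nat_mult of_nat_numeral)
      then show ?thesis by simp
    qed
    have hp: "c powr (real n / 2) = sqrt c ^ n" if "c > 0" for c :: real and n
      using that by (simp add: powr_half_sqrt[symmetric] powr_power)
    have mu: "mu m * 2 = 2 ^ b * 2 ^ m * M"
      using m by (cases m) (simp_all add: mu_def M_def b_def power_add)
    have mu_pos: "mu m > 0" by (simp add: mu_def)
    have "sqrt (mu m) * sqrt 2 = sqrt 2 ^ b * sqrt 2 ^ m * sqrt M"
      using arg_cong[OF mu, of sqrt] by (simp add: real_sqrt_mult real_sqrt_power)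
    then have s: "sqrt (mu m) = sqrt 2 ^ b * sqrt 2 ^ m * sqrt M / sqrt 2"
      by (simp add: field_simps)
    have four: "sqrt (4 * pi) = sqrt 2 * sqrt (2 * pi)"
      by (simp flip: real_sqrt_mult)
    have two: "sqrt (2 * pi * (2 / M)) = sqrt (2 * pi) * sqrt 2 / sqrt M"
      by (simp add: real_sqrt_divide real_sqrt_mult)
    show ?thesis unfolding bm powr_add s four two
      using hp[of 2 b] hp[of "2 * pi" b] hp[of "2 * pi" m] M
      by (simp add: power_divide power_mult_distrib field_simps)
  qed
  have ex: "- g\<^sup>2 / 2 + (- (D - 2 * g * S + real m * g\<^sup>2) / 4 + - R / 2)
    = - (1 / 4) * (D + 2 * R - 1 / M * S\<^sup>2) + - (g - S / M)\<^sup>2 / (2 * (2 / M))"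
  proof -
    have rm: "real m = M - 2" by (simp add: M_def)
    show ?thesis unfolding rm using M by (simp add: field_simps power2_eq_square)
  qed
  have "std_normal_density g * (\<Prod>p\<in>upper_idx m. normal_density (on_diag g p) (entry_sd p) (x p))
    = (1 / sqrt (2 * pi) * ((1 / sqrt (4 * pi)) ^ m * (1 / sqrt (2 * pi)) ^ b))
      * exp (- g\<^sup>2 / 2 + (- (D - 2 * g * S + real m * g\<^sup>2) / 4 + - R / 2))"
    unfolding prod_upper_idx diag off std_normal_density_def exp_add by (simp add: mult_ac)
  also have "\<dots> = gamma_star_density m (mat_of_upper m x) * normal_density (S / M) (sqrt (2 / M)) g"
    unfolding const ex exp_add gamma_star_density_def mat_tr_mat_of_upper mat_tr_square_mat_of_upper normal_density_def
    using M M2 by (simp add: S_def[symmetric] D_def[symmetric] R_def[symmetric] b_def[symmetric])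
  finally show ?thesis by (simp add: S_def M_def)
qed

text \<open>
  Under \<^const>\<open>gamma_star\<close> a random matrix is a matrix from \<^const>\<open>goe\<close> plus an independent
  standard normal multiple of the identity.
\<close>

lemma nn_integral_gamma_star:
  assumes m: "m > 0" and f: "(\<lambda>x. f (mat_of_upper m x)) \<in> borel_measurable (upper_lborel m)"
  shows "(\<integral>\<^sup>+X. f X \<partial>gamma_star m)
    = (\<integral>\<^sup>+g. ennreal (std_normal_density g) * (\<integral>\<^sup>+x. f (mat_of_upper m (shift_diag m g x)) \<partial>goe m) \<partial>lborel)"
proof -
  interpret sigma_finite_measure "upper_lborel m" by (rule sigma_finite_upper_lborel)
  interpret pair_sigma_finite "lborel :: real measure" "upper_lborel m" ..
  note f [measurable]
  define w where "w = (\<lambda>g x. \<Prod>p\<in>upper_idx m. normal_density (on_diag g p) (entry_sd p) (x p))"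
  have w0: "w g x \<ge> 0" for g x by (simp add: w_def prod_nonneg)
  have w_meas [measurable]: "(\<lambda>z. w (fst z) (snd z)) \<in> borel_measurable (lborel \<Otimes>\<^sub>M upper_lborel m)"
    unfolding w_def on_diag_def normal_density_def by measurable
  have [measurable]: "(\<lambda>x. gamma_star_density m (mat_of_upper m x)) \<in> borel_measurable (upper_lborel m)"
    unfolding gamma_star_density_def mat_tr_mat_of_upper mat_tr_square_mat_of_upper
    by (intro borel_measurable_times borel_measurable_const borel_measurable_exp[THEN measurable_compose[rotated]]
       borel_measurable_diff borel_measurable_add borel_measurable_sum borel_measurable_power
       measurable_component_singleton[of _ _ "\<lambda>_. lborel", simplified measurable_lborel1])
       (auto simp: upper_idx_def strict_upper_idx_def)
  have dens [measurable]: "gamma_star_density m \<in> borel_measurable (sym_lebesgue m)"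
    unfolding sym_lebesgue_def by (rule measurable_embed_measure1) simp
  have fm [measurable]: "f \<in> borel_measurable (sym_lebesgue m)"
    unfolding sym_lebesgue_def by (rule measurable_embed_measure1) simp
  have "(\<integral>\<^sup>+X. f X \<partial>gamma_star m) = (\<integral>\<^sup>+X. ennreal (gamma_star_density m X) * f X \<partial>sym_lebesgue m)"
    unfolding gamma_star_def by (subst nn_integral_density) auto
  also have "\<dots> = (\<integral>\<^sup>+x. ennreal (gamma_star_density m (mat_of_upper m x)) * f (mat_of_upper m x) \<partial>upper_lborel m)"
    unfolding sym_lebesgue_def
    by (subst nn_integral_embed_measure'[OF inj_on_mat_of_upper]) (auto simp: sym_lebesgue_def[symmetric])
  also have "\<dots> = (\<integral>\<^sup>+x. (\<integral>\<^sup>+g. ennreal (std_normal_density g * w g x) * f (mat_of_upper m x) \<partial>lborel) \<partial>upper_lborel m)"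
  proof (intro nn_integral_cong)
    fix x
    define \<sigma> where "\<sigma> = sqrt (2 / real (m + 2))"
    define c where "c = (\<Sum>i<m. x (i, i)) / real (m + 2)"
    have \<sigma>: "\<sigma> > 0" by (simp add: \<sigma>_def)
    have "(\<integral>\<^sup>+g. ennreal (std_normal_density g * w g x) * f (mat_of_upper m x) \<partial>lborel)
        = (\<integral>\<^sup>+g. ennreal (normal_density c \<sigma> g) * (ennreal (gamma_star_density m (mat_of_upper m x)) * f (mat_of_upper m x)) \<partial>lborel)"
      by (intro nn_integral_cong)
         (simp add: w_def gaussian_factorisation[OF m] c_def \<sigma>_def ennreal_mult gamma_star_density_nonneg mult_ac)
    also have "\<dots> = (\<integral>\<^sup>+g. ennreal (normal_density c \<sigma> g) \<partial>lborel) * (ennreal (gamma_star_density m (mat_of_upper m x)) * f (mat_of_upper m x))"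
      by (rule nn_integral_multc) simp
    also have "(\<integral>\<^sup>+g. ennreal (normal_density c \<sigma> g) \<partial>lborel) = 1"
      using \<sigma> by (simp add: nn_integral_eq_integral)
    finally show "ennreal (gamma_star_density m (mat_of_upper m x)) * f (mat_of_upper m x)
        = (\<integral>\<^sup>+g. ennreal (std_normal_density g * w g x) * f (mat_of_upper m x) \<partial>lborel)" by simp
  qed
  also have "\<dots> = (\<integral>\<^sup>+g. (\<integral>\<^sup>+x. ennreal (std_normal_density g * w g x) * f (mat_of_upper m x) \<partial>upper_lborel m) \<partial>lborel)"
    by (rule Fubini') measurable
  also have "\<dots> = (\<integral>\<^sup>+g. ennreal (std_normal_density g) * (\<integral>\<^sup>+x. f (mat_of_upper m (shift_diag m g x)) \<partial>goe m) \<partial>lborel)"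
  proof (intro nn_integral_cong)
    fix g
    have [measurable]: "w g \<in> borel_measurable (upper_lborel m)"
      unfolding w_def by measurable
    have "(\<integral>\<^sup>+x. ennreal (std_normal_density g * w g x) * f (mat_of_upper m x) \<partial>upper_lborel m)
      = (\<integral>\<^sup>+x. ennreal (std_normal_density g) * (ennreal (w g x) * f (mat_of_upper m x)) \<partial>upper_lborel m)"
      by (intro nn_integral_cong) (simp add: ennreal_mult w0 mult_ac)
    also have "\<dots> = ennreal (std_normal_density g) * (\<integral>\<^sup>+x. ennreal (w g x) * f (mat_of_upper m x) \<partial>upper_lborel m)"
      by (rule nn_integral_cmult) simp
    also have "(\<integral>\<^sup>+x. ennreal (w g x) * f (mat_of_upper m x) \<partial>upper_lborel m)
        = (\<integral>\<^sup>+x. f (mat_of_upper m (shift_diag m g x)) \<partial>goe m)"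
      unfolding w_def by (rule nn_integral_goe_shift[symmetric]) (rule f)
    finally show "(\<integral>\<^sup>+x. ennreal (std_normal_density g * w g x) * f (mat_of_upper m x) \<partial>upper_lborel m)
        = ennreal (std_normal_density g) * (\<integral>\<^sup>+x. f (mat_of_upper m (shift_diag m g x)) \<partial>goe m)" .
  qed
  finally show ?thesis .
qed

section \<open>Two-sided bounds for the mean absolute determinant\<close>

definition shifted_det_mean :: "nat \<Rightarrow> real \<Rightarrow> ennreal" where
  "shifted_det_mean m t = (\<integral>\<^sup>+x. ennreal \<bar>Determinant.det (mat_of_upper m (shift_diag m t x))\<bar> \<partial>goe m)"

lemma measurable_shifted_det:
  "(\<lambda>(t, x). ennreal \<bar>Determinant.det (mat_of_upper m (shift_diag m t x))\<bar>) \<in> borel_measurable (borel \<Otimes>\<^sub>M goe m)"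
proof -
  have "(\<lambda>z. ennreal \<bar>Determinant.det (mat_of_upper m z)\<bar>) \<in> borel_measurable (upper_lborel m)"
    by measurable
  from measurable_compose[OF measurable_shift_diag this] show ?thesis
    by (simp add: case_prod_beta' measurable_cong_sets[OF sets_pair_measure_cong[OF refl sets_goe] refl])
qed

lemma measurable_shifted_det_mean [measurable]: "shifted_det_mean m \<in> borel_measurable borel"
proof -
  interpret prob_space "goe m" by (rule prob_space_goe)
  show ?thesis unfolding shifted_det_mean_def
    using borel_measurable_nn_integral[OF measurable_shifted_det] by simp
qed

lemma mat_of_upper_shift_diag:
  "mat_of_upper m (shift_diag m t x)
    = mat m m (\<lambda>(i, j). x (min i j, max i j) + (if i = j then t else 0))"
  unfolding mat_of_upper_def
  by (rule eq_matI) (auto simp: shift_diag_def on_diag_def upper_idx_def min_def max_def)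

text \<open>
  The choice of \<open>8 * m\<close> makes every exponent small enough for
  \<open>nn_integral_normal_exp_square_le\<close>: \<open>1 / (8 * m)\<close> for entries of variance at most 2, and \<open>1 / 8\<close>
  for the standard normal shift \<open>t\<close>.  The bound \<open>(x + t)\<^sup>2 \<le> 2 * x\<^sup>2 + 2 * t\<^sup>2\<close> separates
  \<open>t\<close> from the entries.
\<close>

lemma abs_det_shift_le:
  assumes m: "m > 0"
  shows "\<bar>Determinant.det (mat_of_upper m (shift_diag m t x))\<bar>
    \<le> (8 * real m) powr (real m / 2) * exp (1/8 * t\<^sup>2) * (\<Prod>p\<in>upper_idx m. exp (1 / (8 * real m) * (x p)\<^sup>2))"
proof -
  define y where "y = shift_diag m t x"
  define D where "D = (\<Sum>i<m. (x (i, i))\<^sup>2)"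
  define R where "R = (\<Sum>p\<in>strict_upper_idx m. (x p)\<^sup>2)"
  have "(\<Sum>i<m. \<Sum>j<m. (y (min i j, max i j))\<^sup>2) = (\<Sum>i<m. (x (i, i) + t)\<^sup>2) + 2 * R"
  proof -
    have "(\<Sum>p\<in>strict_upper_idx m. (y p)\<^sup>2) = R" unfolding R_def
      by (intro sum.cong) (auto simp: y_def shift_diag_def on_diag_def upper_idx_eq)
    moreover have "(\<Sum>i<m. (y (i, i))\<^sup>2) = (\<Sum>i<m. (x (i, i) + t)\<^sup>2)"
      by (intro sum.cong) (auto simp: y_def shift_diag_def on_diag_def upper_idx_eq)
    ultimately show ?thesis by (simp add: sum_symmetric_entries)
  qed
  also have "(\<Sum>i<m. (x (i, i) + t)\<^sup>2) \<le> (\<Sum>i<m. 2 * (x (i, i))\<^sup>2 + 2 * t\<^sup>2)"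
  proof (intro sum_mono)
    fix i
    show "(x (i, i) + t)\<^sup>2 \<le> 2 * (x (i, i))\<^sup>2 + 2 * t\<^sup>2"
      using zero_le_power2[of "x (i, i) - t"] by (simp add: power2_eq_square algebra_simps)
  qed
  also have "\<dots> + 2 * R = 2 * (D + R) + 2 * real m * t\<^sup>2"
    by (simp add: sum.distrib D_def sum_distrib_left)
  finally have norm: "(\<Sum>i<m. \<Sum>j<m. (y (min i j, max i j))\<^sup>2) / (2 * (8 * real m))
      \<le> (D + R) / (8 * real m) + 1/8 * t\<^sup>2"
    using m by (simp add: field_simps)
  have "\<bar>Determinant.det (mat_of_upper m y)\<bar>
    \<le> (8 * real m) powr (real m / 2) * exp ((\<Sum>i<m. \<Sum>j<m. (y (min i j, max i j))\<^sup>2) / (2 * (8 * real m)))"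
    unfolding mat_of_upper_def using m by (intro abs_det_le_exp_frobenius) simp
  also have "\<dots> \<le> (8 * real m) powr (real m / 2) * exp ((D + R) / (8 * real m) + 1/8 * t\<^sup>2)"
    using norm by (intro mult_left_mono) auto
  also have "exp ((D + R) / (8 * real m) + 1/8 * t\<^sup>2)
      = exp (1/8 * t\<^sup>2) * (\<Prod>p\<in>upper_idx m. exp (1 / (8 * real m) * (x p)\<^sup>2))"
    by (simp add: exp_add exp_sum[symmetric] sum_distrib_left[symmetric] sum_divide_distrib[symmetric] sum_upper_idx D_def R_def)
  finally show ?thesis by (simp add: y_def mult.assoc)
qed

lemma shifted_det_mean_le:
  assumes m: "m > 0"
  shows "shifted_det_mean m t \<le> ennreal ((8 * real m) powr (real m / 2) * exp (real m)) * ennreal (exp (1/8 * t\<^sup>2))"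
proof -
  interpret product_prob_space "\<lambda>p. density lborel (normal_density 0 (entry_sd p))"
    by (intro product_prob_spaceI prob_space_normal_density) simp
  let ?a = "1 / (8 * real m)"
  let ?c = "(8 * real m) powr (real m / 2) * exp (1/8 * t\<^sup>2)"
  have [measurable]: "(\<lambda>x. \<Prod>p\<in>upper_idx m. ennreal (exp (?a * (x p)\<^sup>2))) \<in> borel_measurable (goe m)"
    by measurable
  have "shifted_det_mean m t \<le> (\<integral>\<^sup>+x. ennreal ?c * (\<Prod>p\<in>upper_idx m. ennreal (exp (?a * (x p)\<^sup>2))) \<partial>goe m)"
    unfolding shifted_det_mean_def
  proof (intro nn_integral_mono)
    fix x
    show "ennreal \<bar>Determinant.det (mat_of_upper m (shift_diag m t x))\<bar>
        \<le> ennreal ?c * (\<Prod>p\<in>upper_idx m. ennreal (exp (?a * (x p)\<^sup>2)))"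
      using ennreal_leI[OF abs_det_shift_le[OF m, of t x]]
      by (simp add: prod_ennreal ennreal_mult'[symmetric] prod_nonneg)
  qed
  also have "\<dots> = ennreal ?c * (\<integral>\<^sup>+x. (\<Prod>p\<in>upper_idx m. ennreal (exp (?a * (x p)\<^sup>2))) \<partial>goe m)"
    by (rule nn_integral_cmult) measurable
  also have "(\<integral>\<^sup>+x. (\<Prod>p\<in>upper_idx m. ennreal (exp (?a * (x p)\<^sup>2))) \<partial>goe m)
      = (\<Prod>p\<in>upper_idx m. \<integral>\<^sup>+y. ennreal (exp (?a * y\<^sup>2)) \<partial>density lborel (normal_density 0 (entry_sd p)))"
    unfolding goe_def
    by (rule product_nn_integral_prod[where f="\<lambda>_ y. ennreal (exp (?a * y\<^sup>2))"]) simp_all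
  also have "\<dots> \<le> (\<Prod>p\<in>upper_idx m. ennreal (exp (1 / real m)))"
  proof (rule prod_mono_ennreal)
    fix p
    have sd: "(entry_sd p)\<^sup>2 \<le> 2" by (simp add: entry_sd_def)
    have "4 * ?a * (entry_sd p)\<^sup>2 \<le> 4 * ?a * 2" by (intro mult_left_mono sd) simp
    then have le: "4 * ?a * (entry_sd p)\<^sup>2 \<le> 1 / real m" by simp
    moreover have "1 / real m \<le> 1" using m by simp
    ultimately have le1: "4 * ?a * (entry_sd p)\<^sup>2 \<le> 1" by linarith
    have "(\<integral>\<^sup>+y. ennreal (exp (?a * y\<^sup>2)) \<partial>density lborel (normal_density 0 (entry_sd p)))
        = (\<integral>\<^sup>+y. ennreal (normal_density 0 (entry_sd p) y * exp (?a * y\<^sup>2)) \<partial>lborel)"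
      by (subst nn_integral_density) (simp_all add: ennreal_mult')
    also have "\<dots> \<le> ennreal (exp (4 * ?a * (entry_sd p)\<^sup>2))"
      by (rule nn_integral_normal_exp_square_le[OF _ _ le1]) simp_all
    also have "\<dots> \<le> ennreal (exp (1 / real m))"
      using le by (intro ennreal_leI) simp
    finally show "(\<integral>\<^sup>+y. ennreal (exp (?a * y\<^sup>2)) \<partial>density lborel (normal_density 0 (entry_sd p)))
        \<le> ennreal (exp (1 / real m))" .
  qed
  also have "\<dots> = ennreal (exp (real (card (upper_idx m)) / real m))"
    by (simp add: ennreal_power exp_of_nat_mult[symmetric])
  also have "\<dots> \<le> ennreal (exp (real m))"
  proof -
    have "card (upper_idx m) \<le> card ({..<m} \<times> {..<m})"
      by (intro card_mono) (auto simp: upper_idx_def)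
    then have "real (card (upper_idx m)) \<le> real m * real m"
      unfolding card_cartesian_product by (simp flip: of_nat_mult)
    then show ?thesis using m by (intro ennreal_leI) (simp add: field_simps)
  qed
  finally have "shifted_det_mean m t \<le> ennreal ?c * ennreal (exp (real m))"
    by (simp add: mult_left_mono)
  then show ?thesis by (simp add: ennreal_mult'[symmetric] mult_ac)
qed

lemma nn_integral_abs_det_gamma_star:
  assumes "m > 0"
  shows "(\<integral>\<^sup>+X. ennreal \<bar>Determinant.det X\<bar> \<partial>gamma_star m)
    = (\<integral>\<^sup>+t. ennreal (std_normal_density t) * shifted_det_mean m t \<partial>lborel)"
  unfolding shifted_det_mean_def using assms
  by (rule nn_integral_gamma_star) measurable

lemma mean_abs_det_le:
  assumes m: "m > 0"
  shows "(\<integral>\<^sup>+X. ennreal \<bar>Determinant.det X\<bar> \<partial>gamma_star m)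
    \<le> ennreal ((8 * real m) powr (real m / 2) * exp (real m + 1))"
proof -
  let ?c = "(8 * real m) powr (real m / 2) * exp (real m)"
  have "(\<integral>\<^sup>+X. ennreal \<bar>Determinant.det X\<bar> \<partial>gamma_star m)
      \<le> (\<integral>\<^sup>+t. ennreal ?c * ennreal (std_normal_density t * exp (1/8 * t\<^sup>2)) \<partial>lborel)"
    unfolding nn_integral_abs_det_gamma_star[OF m]
  proof (intro nn_integral_mono)
    fix t
    have "ennreal (std_normal_density t) * shifted_det_mean m t
        \<le> ennreal (std_normal_density t) * (ennreal ?c * ennreal (exp (1/8 * t\<^sup>2)))"
      by (intro mult_left_mono shifted_det_mean_le[OF m]) simp
    then show "ennreal (std_normal_density t) * shifted_det_mean m t
        \<le> ennreal ?c * ennreal (std_normal_density t * exp (1/8 * t\<^sup>2))"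
      by (simp add: ennreal_mult mult_ac)
  qed
  also have "\<dots> = ennreal ?c * (\<integral>\<^sup>+t. ennreal (std_normal_density t * exp (1/8 * t\<^sup>2)) \<partial>lborel)"
    by (rule nn_integral_cmult) measurable
  also have "\<dots> \<le> ennreal ?c * ennreal (exp 1)"
  proof (rule mult_left_mono)
    have "(\<integral>\<^sup>+t. ennreal (std_normal_density t * exp (1/8 * t\<^sup>2)) \<partial>lborel) \<le> ennreal (exp (4 * (1/8) * 1\<^sup>2))"
      by (rule nn_integral_normal_exp_square_le) simp_all
    also have "\<dots> \<le> ennreal (exp 1)" by (intro ennreal_leI) simp
    finally show "(\<integral>\<^sup>+t. ennreal (std_normal_density t * exp (1/8 * t\<^sup>2)) \<partial>lborel) \<le> ennreal (exp 1)" .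
  qed simp
  also have "\<dots> = ennreal ((8 * real m) powr (real m / 2) * exp (real m + 1))"
    by (simp add: ennreal_mult'[symmetric] exp_add mult.assoc)
  finally show ?thesis .
qed

lemma shifted_det_mean_binomial_sum:
  assumes h: "h \<ge> 0"
  shows "ennreal (fact m * h ^ m) \<le> (\<Sum>k\<le>m. ennreal (real (m choose k)) * shifted_det_mean m (u + real k * h))"
proof -
  interpret prob_space "goe m" by (rule prob_space_goe)
  let ?f = "\<lambda>t x. ennreal \<bar>Determinant.det (mat_of_upper m (shift_diag m t x))\<bar>"
  have [measurable]: "?f t \<in> borel_measurable (goe m)" for t
    using measurable_compose[OF _ measurable_shifted_det, of "Pair t" "goe m" m] by simp
  have "ennreal (fact m * h ^ m) = (\<integral>\<^sup>+x. ennreal (fact m * h ^ m) \<partial>goe m)"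
    by (simp add: emeasure_space_1)
  also have "\<dots> \<le> (\<integral>\<^sup>+x. (\<Sum>k\<le>m. ennreal (real (m choose k)) * ?f (u + real k * h) x) \<partial>goe m)"
  proof (intro nn_integral_mono)
    fix x
    have "ennreal (fact m * h ^ m) \<le> ennreal (\<Sum>k\<le>m. real (m choose k) * \<bar>Determinant.det (mat_of_upper m (shift_diag m (u + real k * h) x))\<bar>)"
      unfolding mat_of_upper_shift_diag
      by (intro ennreal_leI det_shift_le_binomial_sum h)
    also have "\<dots> = (\<Sum>k\<le>m. ennreal (real (m choose k)) * ?f (u + real k * h) x)"
      by (simp add: sum_ennreal[symmetric] ennreal_mult del: sum_ennreal)
    finally show "ennreal (fact m * h ^ m) \<le> (\<Sum>k\<le>m. ennreal (real (m choose k)) * ?f (u + real k * h) x)" .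
  qed
  also have "\<dots> = (\<Sum>k\<le>m. \<integral>\<^sup>+x. ennreal (real (m choose k)) * ?f (u + real k * h) x \<partial>goe m)"
    by (rule nn_integral_sum) measurable
  also have "\<dots> = (\<Sum>k\<le>m. ennreal (real (m choose k)) * shifted_det_mean m (u + real k * h))"
    unfolding shifted_det_mean_def by (intro sum.cong refl nn_integral_cmult) measurable
  finally show ?thesis .
qed

text \<open>
  Averaging the finite difference bound over \<open>u \<in> [0, 1]\<close>.  Each shifted unit interval lies in
  \<open>[0, 1 + m * h]\<close>, where the standard normal density is at least its value at the right end,
  so each of the shifted averages is bounded by a multiple of the same mean; the binomial
  coefficients sum to \<open>2 ^ m\<close>.
\<close>

lemma mean_abs_det_ge:
  assumes m: "m > 0" and h: "h \<ge> 0"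
  shows "ennreal (std_normal_density (1 + real m * h) * (fact m * h ^ m))
    \<le> ennreal (2 ^ m) * (\<integral>\<^sup>+X. ennreal \<bar>Determinant.det X\<bar> \<partial>gamma_star m)"
proof -
  define J where "J = (\<integral>\<^sup>+X. ennreal \<bar>Determinant.det X\<bar> \<partial>gamma_star m)"
  define c where "c = std_normal_density (1 + real m * h)"
  let ?F = "shifted_det_mean m"
  have c0: "c \<ge> 0" by (simp add: c_def)
  have shift: "(\<integral>\<^sup>+u. ennreal c * ?F (u + real k * h) * indicator {0..1} u \<partial>lborel) \<le> J" if k: "k \<le> m" for k
  proof -
    have "(\<integral>\<^sup>+u. ennreal c * ?F (u + real k * h) * indicator {0..1} u \<partial>lborel)
       \<le> (\<integral>\<^sup>+u. ennreal (std_normal_density (real k * h + 1 * u)) * ?F (real k * h + 1 * u) \<partial>lborel)"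
    proof (intro nn_integral_mono)
      fix u :: real
      show "ennreal c * ?F (u + real k * h) * indicator {0..1} u
        \<le> ennreal (std_normal_density (real k * h + 1 * u)) * ?F (real k * h + 1 * u)"
      proof (cases "u \<in> {0..1}")
        case True
        have "real k * h \<le> real m * h" using k h by (intro mult_right_mono) auto
        then have "0 \<le> real k * h + u" "real k * h + u \<le> 1 + real m * h"
          using True h by auto
        then have "(real k * h + u)\<^sup>2 \<le> (1 + real m * h)\<^sup>2" by (intro power_mono) auto
        then have "c \<le> std_normal_density (real k * h + u)"
          unfolding c_def std_normal_density_def by (intro mult_left_mono) auto
        then show ?thesis using True
          by (auto simp: add.commute intro!: mult_right_mono ennreal_leI)
      qed simp
    qed
    also have "\<dots> = (\<integral>\<^sup>+t. ennreal (std_normal_density t) * ?F t \<partial>lborel)"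
      using nn_integral_real_affine[of "\<lambda>t. ennreal (std_normal_density t) * ?F t" 1 "real k * h"]
      by simp
    also have "\<dots> = J" by (simp add: J_def nn_integral_abs_det_gamma_star[OF m])
    finally show ?thesis .
  qed
  have "ennreal (c * (fact m * h ^ m)) = (\<integral>\<^sup>+u. ennreal c * ennreal (fact m * h ^ m) * indicator {0..1} (u::real) \<partial>lborel)"
    using c0 h by (simp add: nn_integral_cmult_indicator ennreal_mult)
  also have "\<dots> \<le> (\<integral>\<^sup>+u. (\<Sum>k\<le>m. ennreal (real (m choose k)) * (ennreal c * ?F (u + real k * h) * indicator {0..1} u)) \<partial>lborel)"
  proof (intro nn_integral_mono)
    fix u :: real
    have "ennreal c * ennreal (fact m * h ^ m) * indicator {0..1} u
      \<le> ennreal c * (\<Sum>k\<le>m. ennreal (real (m choose k)) * ?F (u + real k * h)) * indicator {0..1} u"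
      by (intro mult_right_mono mult_left_mono shifted_det_mean_binomial_sum h) auto
    also have "\<dots> = (\<Sum>k\<le>m. ennreal (real (m choose k)) * (ennreal c * ?F (u + real k * h) * indicator {0..1} u))"
      by (simp add: sum_distrib_left sum_distrib_right mult_ac)
    finally show "ennreal c * ennreal (fact m * h ^ m) * indicator {0..1} u \<le> \<dots>" .
  qed
  also have "\<dots> = (\<Sum>k\<le>m. \<integral>\<^sup>+u. ennreal (real (m choose k)) * (ennreal c * ?F (u + real k * h) * indicator {0..1} u) \<partial>lborel)"
    by (rule nn_integral_sum) measurable
  also have "\<dots> = (\<Sum>k\<le>m. ennreal (real (m choose k)) * (\<integral>\<^sup>+u. ennreal c * ?F (u + real k * h) * indicator {0..1} u \<partial>lborel))"
    by (intro sum.cong refl nn_integral_cmult) measurable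
  also have "\<dots> \<le> (\<Sum>k\<le>m. ennreal (real (m choose k)) * J)"
    by (intro sum_mono mult_left_mono shift) auto
  also have "\<dots> = ennreal (2 ^ m) * J"
  proof -
    have "(\<Sum>k\<le>m. real (m choose k)) = 2 ^ m"
      using choose_row_sum[of m] by (metis of_nat_numeral of_nat_power of_nat_sum)
    then show ?thesis by (simp add: sum_distrib_right[symmetric] sum_ennreal)
  qed
  finally show ?thesis by (simp add: c_def J_def)
qed

section \<open>Bounds for factorials and the Gamma function\<close>

lemma ln_fact_le: "ln (fact n) \<le> real n * ln (real n)"
proof (cases "n = 0")
  case False
  have "(fact n :: real) \<le> real n ^ n" by (metis fact_le_power of_nat_power le_refl)
  then have "ln (fact n :: real) \<le> ln (real n ^ n)" using False by (subst ln_le_cancel_iff) auto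
  then show ?thesis using False by (simp add: ln_realpow)
qed simp

lemma ln_fact_ge: 
  assumes "n > 0"
  shows "real n * ln (real n) - real n \<le> ln (fact n)"
proof -
  have sums: "(\<lambda>k. real n ^ k / fact k) sums exp (real n)"
    using exp_converges[of "real n"] by (simp add: field_simps)
  have "real n ^ n / fact n \<le> exp (real n)"
    using sum_le_suminf[OF sums_summable[OF sums], of "{n}"] sums_unique[OF sums] by simp
  then have "ln (real n ^ n) \<le> ln (exp (real n) * fact n)"
    using assms by (subst ln_le_cancel_iff) (auto simp: field_simps)
  then show ?thesis using assms by (simp add: ln_realpow ln_mult)
qed

text \<open>
  \<open>1 + m / 2\<close> is the midpoint of \<open>1\<close> and \<open>1 + m\<close>, so logarithmic convexity gives
  \<open>\<Gamma>(1 + m / 2) \<le> sqrt (m!)\<close>.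
\<close>

lemma ln_Gamma_half_le:
  assumes "m > 0"
  shows "ln (Gamma (1 + real m / 2)) \<le> real m / 2 * ln (real m)"
proof -
  have "(ln \<circ> Gamma) ((1 - 1/2) *\<^sub>R 1 + (1/2) *\<^sub>R (1 + real m)) \<le> (1 - 1/2) * (ln \<circ> Gamma) 1 + (1/2) * (ln \<circ> Gamma) (1 + real m)"
    by (rule convex_onD[OF log_convex_Gamma_real]) auto
  moreover have "(1 - 1/2) *\<^sub>R 1 + (1/2) *\<^sub>R (1 + real m) = 1 + real m / 2" by (simp add: field_simps)
  ultimately have "ln (Gamma (1 + real m / 2)) \<le> 1/2 * ln (fact m)"
    by (simp add: Gamma_fact)
  then show ?thesis using ln_fact_le[of m] by simp
qed

text \<open>
  On \<open>[a, a + 1]\<close> the integrand \<open>t powr a * exp (- t)\<close> of \<open>\<Gamma>(1 + a)\<close> is at least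
  \<open>a powr a * exp (- (a + 1))\<close>.
\<close>

lemma ln_Gamma_ge:
  assumes a: "a > (0::real)"
  shows "a * ln a - a - 1 \<le> ln (Gamma (1 + a))"
proof -
  have G: "((\<lambda>t. t powr (1 + a - 1) / exp t) has_integral Gamma (1 + a)) {0..}"
    using a by (intro Gamma_integral_real) simp
  have "(\<lambda>t. t powr (1 + a - 1) / exp t) integrable_on {a..a+1}"
    using a by (intro integrable_continuous_interval continuous_intros) auto
  then obtain i where i: "((\<lambda>t. t powr (1 + a - 1) / exp t) has_integral i) {a..a+1}"
    by (auto simp: integrable_on_def)
  have "((\<lambda>t::real. a powr a / exp (a + 1)) has_integral a powr a / exp (a + 1)) {a..a+1}"
    using has_integral_const_real[of "a powr a / exp (a + 1)" a "a + 1"] by simp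
  from this i have "a powr a / exp (a + 1) \<le> i"
    by (rule has_integral_le) (use a in \<open>auto intro!: frac_le powr_mono2\<close>)
  also have "i \<le> Gamma (1 + a)"
    by (rule has_integral_subset_le[OF _ i G]) (use a in auto)
  finally have "ln (a powr a / exp (a + 1)) \<le> ln (Gamma (1 + a))"
    using a by (subst ln_le_cancel_iff) (auto intro: Gamma_real_pos)
  then show ?thesis using a by (simp add: ln_div ln_powr)
qed

lemma Gamma_factor_bound:
  assumes m: "m > 0"
  shows "\<bar>real m / 2 * ln (4 * pi / real (m + 4)) + ln (Gamma (1 + real m / 2))\<bar> \<le> 10 * real m"
proof (rule abs_leI)
  define x where "x = real m"
  have x: "x \<ge> 1" using m by (simp add: x_def)
  have lnq: "ln (4 * pi / (x + 4)) = ln (4 * pi) - ln (x + 4)" using x by (simp add: ln_div)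
  have "x / 2 * ln x \<le> x / 2 * ln (x + 4)" using x by (intro mult_left_mono) auto
  then have "ln (Gamma (1 + x / 2)) \<le> x / 2 * ln (x + 4)"
    using ln_Gamma_half_le[OF m] by (simp add: x_def)
  moreover have "ln (4 * pi) \<le> 16"
    using ln_le_minus_one[of "4 * pi"] pi_less_4 pi_gt_zero by simp
  then have "x / 2 * ln (4 * pi) \<le> x / 2 * 16" using x by (intro mult_left_mono) auto
  ultimately have "x / 2 * ln (4 * pi / (x + 4)) + ln (Gamma (1 + x / 2)) \<le> 8 * x"
    unfolding lnq right_diff_distrib by linarith
  then show "real m / 2 * ln (4 * pi / real (m + 4)) + ln (Gamma (1 + real m / 2)) \<le> 10 * real m"
    using x by (simp add: x_def)
  have "ln (x + 4) \<le> ln (10 * (x / 2))" using x by (subst ln_le_cancel_iff) auto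
  also have "\<dots> = ln 10 + ln (x / 2)" using x by (subst ln_mult) auto
  finally have "ln (x + 4) - ln (x / 2) \<le> 9" using ln_le_minus_one[of "10::real"] by simp
  then have "x / 2 * (ln (x + 4) - ln (x / 2)) \<le> x / 2 * 9" using x by (intro mult_left_mono) auto
  moreover have "x / 2 * ln (x / 2) - x / 2 - 1 \<le> ln (Gamma (1 + x / 2))"
    using x by (intro ln_Gamma_ge) simp
  moreover have "0 \<le> x / 2 * ln (4 * pi)"
    using x pi_gt3 by (intro mult_nonneg_nonneg ln_ge_zero) auto
  ultimately have "- (x / 2 * ln (4 * pi / (x + 4)) + ln (Gamma (1 + x / 2))) \<le> 10 * x"
    using x unfolding lnq right_diff_distrib by linarith
  then show "- (real m / 2 * ln (4 * pi / real (m + 4)) + ln (Gamma (1 + real m / 2))) \<le> 10 * real m"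
    by (simp add: x_def)
qed

section \<open>Asymptotics\<close>

text \<open>
  The upper bound for the mean also shows that the absolute determinant is integrable, so that
  the Bochner integral is the expected value and not the default 0.
\<close>

lemma ennreal_I_const:
  assumes m: "m > 0"
  shows "ennreal (I_const m) = (\<integral>\<^sup>+X. ennreal \<bar>Determinant.det X\<bar> \<partial>gamma_star m)"
proof -
  have "(\<lambda>X. \<bar>Determinant.det X\<bar>) \<in> borel_measurable (sym_lebesgue m)"
    unfolding sym_lebesgue_def by (rule measurable_embed_measure1) measurable
  then have "(\<lambda>X. \<bar>Determinant.det X\<bar>) \<in> borel_measurable (gamma_star m)"
    by (simp add: gamma_star_def)
  then have "I_const m = enn2real (\<integral>\<^sup>+X. ennreal \<bar>Determinant.det X\<bar> \<partial>gamma_star m)"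
    unfolding I_const_def by (intro integral_eq_nn_integral) auto
  moreover have "(\<integral>\<^sup>+X. ennreal \<bar>Determinant.det X\<bar> \<partial>gamma_star m) < \<infinity>"
    using mean_abs_det_le[OF m] by (rule le_less_trans) simp
  ultimately show ?thesis by simp
qed

lemma ln_I_const_bound:
  assumes m: "m > 0"
  shows "I_const m > 0" and "\<bar>ln (I_const m) - real m / 2 * ln (real m)\<bar> \<le> 10 * real m"
proof -
  define x where "x = real m"
  have x: "x \<ge> 1" using m by (simp add: x_def)
  \<comment> \<open>The lower bound is proportional to \<open>exp (- (1 + m * h)\<^sup>2 / 2) * h ^ m\<close>; a step of this order
    maximises it up to a factor that is exponential in \<open>m\<close>.\<close>
  define h where "h = 1 / sqrt x"
  have h: "h > 0" using x by (simp add: h_def)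
  define c where "c = std_normal_density (1 + x * h)"
  have c: "c > 0" unfolding c_def by (rule normal_density_pos) simp
  have I0: "I_const m \<ge> 0" unfolding I_const_def by simp
  have "ennreal (c * (fact m * h ^ m)) \<le> ennreal (2 ^ m * I_const m)"
    using mean_abs_det_ge[OF m, of h] h I0
    by (simp add: ennreal_I_const[OF m, symmetric] c_def x_def ennreal_mult)
  then have low: "c * (fact m * h ^ m) \<le> 2 ^ m * I_const m"
    using I0 by (simp add: ennreal_le_iff)
  moreover have low0: "0 < c * (fact m * h ^ m)" using c h by simp
  ultimately show I: "I_const m > 0" using I0 by (cases "I_const m = 0") auto
  have "ln (c * (fact m * h ^ m)) \<le> ln (2 ^ m * I_const m)"
    using low low0 by (subst ln_le_cancel_iff) (auto intro: less_le_trans)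
  then have "ln c + (ln (fact m) + x * ln h) \<le> x * ln 2 + ln (I_const m)"
    using c h I by (simp add: ln_mult ln_realpow x_def)
  moreover have "x * ln h = - (x / 2 * ln x)"
    using x by (simp add: h_def ln_div ln_sqrt)
  moreover have "x * ln x - x \<le> ln (fact m)" using ln_fact_ge[OF m] by (simp add: x_def)
  moreover have "x * ln 2 \<le> x * 1" using x ln_le_minus_one[of "2::real"] by (intro mult_left_mono) auto
  moreover have "ln c \<ge> - 4 - 2 * x"
  proof -
    have sx: "sqrt x * sqrt x = x" "sqrt x \<ge> 1" using x by auto
    have "x * h = sqrt x" using x sx by (simp add: h_def field_simps)
    then have "ln c = - ln (sqrt (2 * pi)) - (1 + sqrt x)\<^sup>2 / 2"
      using pi_gt_zero by (simp add: c_def std_normal_density_def ln_div)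
    moreover have "ln (sqrt (2 * pi)) \<le> 4"
      using ln_le_minus_one[of "2 * pi"] pi_less_4 pi_gt_zero by (simp add: ln_sqrt)
    moreover have "(1 + sqrt x)\<^sup>2 \<le> 4 * x"
    proof -
      have "(1 + sqrt x)\<^sup>2 \<le> (2 * sqrt x)\<^sup>2" using sx by (intro power_mono) auto
      then show ?thesis using x by (simp add: power_mult_distrib)
    qed
    ultimately show ?thesis by linarith
  qed
  ultimately have "ln (I_const m) \<ge> x / 2 * ln x - 10 * x" using x by linarith
  moreover have "ln (I_const m) \<le> x / 2 * ln x + 10 * x"
  proof -
    have "ennreal (I_const m) \<le> ennreal ((8 * x) powr (x / 2) * exp (x + 1))"
      using mean_abs_det_le[OF m] by (simp add: ennreal_I_const[OF m] x_def)
    then have "I_const m \<le> (8 * x) powr (x / 2) * exp (x + 1)" by (simp add: ennreal_le_iff)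
    then have "ln (I_const m) \<le> ln ((8 * x) powr (x / 2) * exp (x + 1))"
      using I by (subst ln_le_cancel_iff) (auto intro: less_le_trans)
    also have "\<dots> = x / 2 * ln 8 + x / 2 * ln x + x + 1"
      using x by (simp add: ln_mult ln_powr distrib_left)
    also have "x / 2 * ln 8 \<le> x / 2 * 7"
      using x ln_le_minus_one[of "8::real"] by (intro mult_left_mono) auto
    finally show ?thesis using x by linarith
  qed
  ultimately show "\<bar>ln (I_const m) - real m / 2 * ln (real m)\<bar> \<le> 10 * real m"
    unfolding x_def[symmetric] by linarith
qed

lemma ln_C_const_bound:
  assumes m: "m > 0"
  shows "\<bar>ln (C_const m) - real m / 2 * ln (real m)\<bar> \<le> 20 * real m"
proof -
  have G: "Gamma (1 + real m / 2) > 0" by (intro Gamma_real_pos) (simp add: add_pos_nonneg)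
  have "ln (C_const m) = real m / 2 * ln (4 * pi / real (m + 4)) + ln (Gamma (1 + real m / 2)) + ln (I_const m)"
    unfolding C_const_def using G ln_I_const_bound(1)[OF m] pi_gt_zero
    by (simp add: ln_mult ln_powr less_imp_neq[OF G, symmetric])
  then show ?thesis
    using Gamma_factor_bound[OF m] ln_I_const_bound(2)[OF m] by linarith
qed

lemma asymp_equiv_half_m_ln_m:
  assumes "\<And>m. m > 0 \<Longrightarrow> \<bar>f m - real m / 2 * ln (real m)\<bar> \<le> K * real m"
  shows "f \<sim>[sequentially] (\<lambda>m. real m / 2 * ln (real m))"
proof -
  have "(\<lambda>m. f m - real m / 2 * ln (real m)) \<in> O(\<lambda>m. real m)"
    using assms by (intro bigoI[of _ K] eventually_sequentiallyI[of 1]) auto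
  also have "(\<lambda>m. real m) \<in> o(\<lambda>m. real m / 2 * ln (real m))" by real_asymp
  finally show ?thesis by (simp add: asymp_equiv_altdef)
qed

theorem theorem1p2:
  shows "(\<lambda>m. ln (C_const m)) \<sim>[sequentially] (\<lambda>m. ln (I_const m))
       \<and> (\<lambda>m. ln (I_const m)) \<sim>[sequentially] (\<lambda>m. real m / 2 * ln (real m))"
proof
  have C: "(\<lambda>m. ln (C_const m)) \<sim>[sequentially] (\<lambda>m. real m / 2 * ln (real m))"
    by (rule asymp_equiv_half_m_ln_m) (rule ln_C_const_bound)
  show I: "(\<lambda>m. ln (I_const m)) \<sim>[sequentially] (\<lambda>m. real m / 2 * ln (real m))"
    by (rule asymp_equiv_half_m_ln_m) (rule ln_I_const_bound(2))
  show "(\<lambda>m. ln (C_const m)) \<sim>[sequentially] (\<lambda>m. ln (I_const m))"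
    using C I by (metis asymp_equiv_sym asymp_equiv_trans)
qed

end
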